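(* Let $\mathcal{H}=(V,\mathcal{E})$ be a hypergraph. If $|V|\ge2$, $\bigcup\mathcal{E}=V$ and the automorphism group $Aut(\mathcal{H})$ is $2$-set transitive on $V$, then the Boolean function $f_{\mathcal{H}}$ is irreducible.
   Context: A hypergraph is a pair $\mathcal{H}=(V,\mathcal{E})$ with $V$ a finite nonempty set and $\mathcal{E}$ a set of subsets of $V$ (the empty set is allowed as a hyperedge). An automorphism of $\mathcal{H}$ is a bijection $\varphi:V\to V$ such that for all $E\subseteq V$, $E\in\mathcal{E}$ iff $\varphi(E)\in\mathcal{E}$; $Aut(\mathcal{H})$ is the group of automorphisms. A group $G$ acting on $V$ is $2$-set transitive if for all two-element subsets $e,e'$ of $V$ there is $g\in G$ with $g(e)=e'$. A Boolean function is a map $f:\{0,1\}^n\to\{0,1\}$, $n\ge1$; $\Omega$ is the set of all of them. For $g$ of arity $m$ and $f$ of arity $n$, $g\le f$ ($g$ is a simple minor of $f$) if there is $\sigma:\{1,\dots,n\}\to\{1,\dots,m\}$ with $g(x_1,\dots,x_m)=f(x_{\sigma(1)},\dots,x_{\sigma(n)})$; $g<f$ means $g\le f$ and not $f\le g$. $f$ is irreducible if there is $f'\in\Omega$ with $f'<f$ such that every $g\in\Omega$ with $g<f$ satisfies $g\le f'$. For a hypergraph $\mathcal{H}=(V,\mathcal{E})$ (with $V$ identified with $\{1,\dots,n\}$), $f_{\mathcal{H}}$ is the $n$-ary Boolean function given by evaluating over $GF(2)$ the polynomial $P_{\mathcal{H}}=\sum_{E\in\mathcal{E}}\prod_{i\in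 E}x_i$. *)

theory Defs
  imports "HOL-Library.Z2" "HOL-Algebra.Group_Action"
begin

section \<open>Hypergraphs and their automorphism groups\<close>

definition hypergraph :: "'a set \<Rightarrow> 'a set set \<Rightarrow> bool" where
  "hypergraph V \<E> \<longleftrightarrow> finite V \<and> V \<noteq> {} \<and> \<E> \<subseteq> Pow V"

definition hypergraph_automorphisms :: "'a set \<Rightarrow> 'a set set \<Rightarrow> ('a \<Rightarrow> 'a) set" where
  "hypergraph_automorphisms V \<E> = {\<phi> \<in> Bij V. \<forall>E\<subseteq>V. E \<in> \<E> \<longleftrightarrow> \<phi> ` E \<in> \<E>}"

definition Aut :: "'a set \<Rightarrow> 'a set set \<Rightarrow> ('a \<Rightarrow> 'a) monoid" where
  "Aut V \<E> = (BijGroup V)\<lparr>carrier := hypergraph_automorphisms V \<E>\<rparr>"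

locale two_set_transitive_action = group_action +
  assumes two_set_transitive:
    "\<lbrakk>e \<subseteq> E; card e = 2; e' \<subseteq> E; card e' = 2\<rbrakk> \<Longrightarrow> \<exists>g\<in>carrier G. \<phi> g ` e = e'"

lemma subgroup_hypergraph_automorphisms:
  "subgroup (hypergraph_automorphisms V \<E>) (BijGroup V)"
proof -
  interpret B: group "BijGroup V"
    by (rule group_BijGroup)
  show ?thesis
  proof (rule B.subgroupI)
    show "hypergraph_automorphisms V \<E> \<subseteq> carrier (BijGroup V)"
      by (auto simp: hypergraph_automorphisms_def BijGroup_def)
    have "(\<lambda>x\<in>V. x) ` E = E" if "E \<subseteq> V" for E
      using that by force
    then have "(\<lambda>x\<in>V. x) \<in> hypergraph_automorphisms V \<E>"
      by (simp add: hypergraph_automorphisms_def id_Bij)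
    then show "hypergraph_automorphisms V \<E> \<noteq> {}"
      by blast
  next
    fix a assume a: "a \<in> hypergraph_automorphisms V \<E>"
    then have aB: "a \<in> Bij V" and bij: "bij_betw a V V"
      by (auto simp: hypergraph_automorphisms_def Bij_def)
    have "E \<in> \<E> \<longleftrightarrow> restrict (inv_into V a) V ` E \<in> \<E>" if E: "E \<subseteq> V" for E
    proof -
      have sub: "restrict (inv_into V a) V ` E \<subseteq> V"
        using E Bij_imp_funcset[OF restrict_inv_into_Bij[OF aB]] by blast
      have "a ` restrict (inv_into V a) V ` E = (\<lambda>x. x) ` E"
        unfolding image_image
        by (rule image_cong[OF refl]) (use E bij_betw_inv_into_right[OF bij] in auto)
      then have "a ` restrict (inv_into V a) V ` E = E"
        by simp
      with sub a show ?thesis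
        by (metis (mono_tags, lifting) hypergraph_automorphisms_def mem_Collect_eq)
    qed
    then show "inv\<^bsub>BijGroup V\<^esub> a \<in> hypergraph_automorphisms V \<E>"
      by (simp add: inv_BijGroup[OF aB] hypergraph_automorphisms_def restrict_inv_into_Bij[OF aB])
  next
    fix a b
    assume a: "a \<in> hypergraph_automorphisms V \<E>" and b: "b \<in> hypergraph_automorphisms V \<E>"
    then have aB: "a \<in> Bij V" and bB: "b \<in> Bij V"
      by (auto simp: hypergraph_automorphisms_def)
    have "E \<in> \<E> \<longleftrightarrow> compose V a b ` E \<in> \<E>" if E: "E \<subseteq> V" for E
    proof -
      have "compose V a b ` E = a ` b ` E"
        using E by (force simp: compose_def image_image)
      moreover have "b ` E \<subseteq> V"
        using E Bij_imp_funcset[OF bB] by blast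
      ultimately show ?thesis
        using a b E by (simp add: hypergraph_automorphisms_def)
    qed
    then show "a \<otimes>\<^bsub>BijGroup V\<^esub> b \<in> hypergraph_automorphisms V \<E>"
      using aB bB by (simp add: BijGroup_def hypergraph_automorphisms_def compose_Bij)
  qed
qed

lemma group_action_Aut: "group_action (Aut V \<E>) V (\<lambda>\<phi>. \<phi>)"
proof -
  interpret B: group "BijGroup V"
    by (rule group_BijGroup)
  show ?thesis
    unfolding group_action_def group_hom_def group_hom_axioms_def Aut_def
    using subgroup_hypergraph_automorphisms[of V \<E>]
    by (auto simp: hom_def group_BijGroup B.subgroup_imp_group dest: subgroup.mem_carrier)
qed


section \<open>Boolean functions and simple minors\<close>

text \<open>The set \<open>{0,1}\<close> is represented by the two-element field \<^typ>\<open>bit\<close>. A Boolean function is a pair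
  of its arity and its evaluation map; points of the cube and evaluation maps are extensional, so
  that equality of pairs is equality of functions.\<close>

type_synonym bool_fun = "nat \<times> ((nat \<Rightarrow> bit) \<Rightarrow> bit)"

definition cube :: "nat \<Rightarrow> (nat \<Rightarrow> bit) set" where
  "cube n = {1..n} \<rightarrow>\<^sub>E UNIV"

definition Omega :: "bool_fun set" where
  "Omega = {(n, f). n \<ge> 1 \<and> f \<in> cube n \<rightarrow>\<^sub>E UNIV}"

definition minor :: "bool_fun \<Rightarrow> bool_fun \<Rightarrow> bool" where
  "minor = (\<lambda>(m, g) (n, f). \<exists>\<sigma> \<in> {1..n} \<rightarrow> {1..m}. \<forall>x\<in>cube m. g x = f (\<lambda>i\<in>{1..n}. x (\<sigma> i)))"

definition strict_minor :: "bool_fun \<Rightarrow> bool_fun \<Rightarrow> bool" where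
  "strict_minor g f \<longleftrightarrow> minor g f \<and> \<not> minor f g"

definition irreducible_bool_fun :: "bool_fun \<Rightarrow> bool" where
  "irreducible_bool_fun f \<longleftrightarrow> f \<in> Omega \<and>
     (\<exists>f'\<in>Omega. strict_minor f' f \<and> (\<forall>g\<in>Omega. strict_minor g f \<longrightarrow> minor g f'))"


section \<open>The Boolean function of a hypergraph\<close>

text \<open>The bijection \<open>\<iota> : V \<rightarrow> {1..card V}\<close> is the identification of the vertices with the variable
  indices.\<close>

definition hypergraph_fun :: "('a \<Rightarrow> nat) \<Rightarrow> 'a set \<Rightarrow> 'a set set \<Rightarrow> bool_fun" where
  "hypergraph_fun \<iota> V \<E> = (card V, \<lambda>x\<in>cube (card V). \<Sum>E\<in>\<E>. \<Prod>v\<in>E. x (\<iota> v))"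

end

theory Submission
  imports Defs
begin

text \<open>
  A minor of \<open>f\<close> obtained from an injective map of variables is equivalent to \<open>f\<close>, so every strict
  minor identifies at least two variables. By 2-set transitivity all identifications of two variables
  yield equivalent functions, so one of them, \<open>f'\<close>, dominates all strict minors. It is itself
  strictly below \<open>f\<close>: otherwise \<open>f\<close> would not depend on some variable \<open>v\<close>, but flipping \<open>v\<close> at the
  indicator of an inclusion-minimal hyperedge containing \<open>v\<close> changes the value.
\<close>

text \<open>The variables of the polynomial are the vertices themselves, not their numbers, so
  automorphisms of the hypergraph act on assignments directly.\<close>

definition hpoly :: "'a set set \<Rightarrow> ('a \<Rightarrow> bit) \<Rightarrow> bit" where
  "hpoly \<E> y = (\<Sum>E\<in>\<E>. \<Prod>v\<in>E. y v)"

lemma hpoly_cong: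
  assumes "\<E> \<subseteq> Pow V" and "\<And>v. v \<in> V \<Longrightarrow> y v = z v"
  shows "hpoly \<E> y = hpoly \<E> z"
  unfolding hpoly_def using assms by (intro sum.cong prod.cong) auto

text \<open>This permits reindexing sums over hyperedges. Surjectivity uses both directions of the
  definition: a hyperedge is the image of some subset of \<open>V\<close>, and that subset must
  itself be a hyperedge.\<close>

lemma bij_betw_image_hypergraph_automorphism:
  assumes "\<E> \<subseteq> Pow V" and \<phi>: "\<phi> \<in> hypergraph_automorphisms V \<E>"
  shows "bij_betw ((`) \<phi>) \<E> \<E>"
proof -
  have bij: "bij_betw \<phi> V V" and iff: "\<And>E. E \<subseteq> V \<Longrightarrow> E \<in> \<E> \<longleftrightarrow> \<phi> ` E \<in> \<E>"
    using \<phi> by (auto simp: hypergraph_automorphisms_def Bij_def)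
  have "F \<in> (`) \<phi> ` \<E>" if "F \<in> \<E>" for F
  proof -
    have "F \<subseteq> \<phi> ` V"
      using that assms(1) bij by (auto simp: bij_betw_def)
    then obtain E where "E \<subseteq> V" "F = \<phi> ` E"
      by (meson subset_imageE)
    with iff that show ?thesis by blast
  qed
  moreover have "inj_on ((`) \<phi>) \<E>"
    using inj_on_image_Pow[OF bij_betw_imp_inj_on[OF bij]] assms(1) by (rule inj_on_subset)
  ultimately show ?thesis
    using assms(1) iff by (auto simp: bij_betw_def)
qed

text \<open>An automorphism merely permutes the monomials, so their sum is unchanged.\<close>

lemma hpoly_automorphism:
  assumes "\<E> \<subseteq> Pow V" and \<phi>: "\<phi> \<in> hypergraph_automorphisms V \<E>"
  shows "hpoly \<E> (\<lambda>v. y (\<phi> v)) = hpoly \<E> y"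
proof -
  have inj: "inj_on \<phi> V"
    using \<phi> by (auto simp: hypergraph_automorphisms_def Bij_def bij_betw_def)
  have "hpoly \<E> y = (\<Sum>E\<in>\<E>. \<Prod>v\<in>\<phi> ` E. y v)"
    unfolding hpoly_def
    by (rule sum.reindex_bij_betw[symmetric])
      (rule bij_betw_image_hypergraph_automorphism[OF assms])
  also have "\<dots> = hpoly \<E> (\<lambda>v. y (\<phi> v))"
    unfolding hpoly_def
  proof (rule sum.cong[OF refl])
    fix E assume "E \<in> \<E>"
    then have "inj_on \<phi> E"
      using assms(1) inj by (meson PowD inj_on_subset subsetD)
    then show "(\<Prod>v\<in>\<phi> ` E. y v) = (\<Prod>v\<in>E. y (\<phi> v))"
      by (simp add: prod.reindex)
  qed
  finally show ?thesis ..
qed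

text \<open>At the indicator of a minimal hyperedge \<open>M\<close> through \<open>v\<close>,
  switching \<open>v\<close> from 0 to 1 changes the monomial of \<open>M\<close> alone, and so
  changes the sum by 1.\<close>

lemma hpoly_depends_on:
  assumes "finite V" and "\<E> \<subseteq> Pow V" and "v \<in> \<Union>\<E>"
  obtains y where "hpoly \<E> (y(v := 0)) \<noteq> hpoly \<E> (y(v := 1))"
proof -
  have fin\<E>: "finite \<E>" and fin: "\<And>E. E \<in> \<E> \<Longrightarrow> finite E"
    using assms(1,2) by (auto intro: finite_subset)
  let ?A = "{E \<in> \<E>. v \<in> E}"
  have "finite ?A" "?A \<noteq> {}" using fin\<E> assms(3) by auto
  from finite_has_minimal[OF this] obtain M
    where M: "M \<in> ?A" and min: "\<And>E. E \<in> ?A \<Longrightarrow> E \<subseteq> M \<Longrightarrow> E = M"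
    by metis
  define y :: "'a \<Rightarrow> bit" where "y = (\<lambda>w. if w \<in> M then 1 else 0)"
  have "hpoly \<E> (y(v := 1)) =
      (\<Sum>E\<in>\<E>. (\<Prod>w\<in>E. (y(v := 0)) w) + (if E = M then 1 else 0))"
    unfolding hpoly_def
  proof (rule sum.cong[OF refl])
    fix E assume E: "E \<in> \<E>"
    note finE = fin[OF E]
    \<comment> \<open>Minimality of \<open>M\<close> rules out the remaining case, a proper subset
      of \<open>M\<close> containing \<open>v\<close>.\<close>
    consider "v \<notin> E" | "E = M" | "v \<in> E" "\<not> E \<subseteq> M"
      using min E by blast
    then show "(\<Prod>w\<in>E. (y(v := 1)) w) =
        (\<Prod>w\<in>E. (y(v := 0)) w) + (if E = M then 1 else 0)"
    proof cases
      case 1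
      then have "(\<Prod>w\<in>E. (y(v := 1)) w) = (\<Prod>w\<in>E. (y(v := 0)) w)"
        by (intro prod.cong) auto
      with 1 M show ?thesis by auto
    next
      case 2
      have "(\<Prod>w\<in>E. (y(v := 0)) w) = 0"
        using 2 M finE by (intro prod_zero) auto
      moreover have "(\<Prod>w\<in>E. (y(v := 1)) w) = 1"
        using 2 by (intro prod.neutral) (auto simp: y_def)
      ultimately show ?thesis using 2 by simp
    next
      case 3
      \<comment> \<open>The factor at \<open>w\<close> is 0 for both values of \<open>v\<close>,
        since \<open>w\<close> differs from \<open>v\<close>, which lies in
        \<open>M\<close>.\<close>
      then obtain w where "w \<in> E" "w \<notin> M" by blast
      then have "(\<Prod>w\<in>E. (y(v := 1)) w) = 0"
        using finE M by (intro prod_zero) (auto simp: y_def intro!: bexI[of _ w])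
      moreover have "(\<Prod>w\<in>E. (y(v := 0)) w) = 0"
        using 3 finE by (intro prod_zero) auto
      ultimately show ?thesis using 3 by auto
    qed
  qed
  also have "\<dots> = hpoly \<E> (y(v := 0)) + 1"
    unfolding sum.distrib using M fin\<E> by (simp only: hpoly_def sum.delta) simp
  finally show ?thesis
    by (intro that[of y]) simp
qed

lemma snd_hypergraph_fun:
  assumes "\<E> \<subseteq> Pow V" and "\<iota> ` V \<subseteq> {1..card V}"
  shows "snd (hypergraph_fun \<iota> V \<E>) (\<lambda>i\<in>{1..card V}. z i) = hpoly \<E> (\<lambda>v. z (\<iota> v))"
proof -
  have "snd (hypergraph_fun \<iota> V \<E>) (\<lambda>i\<in>{1..card V}. z i) =
      hpoly \<E> (\<lambda>v. (\<lambda>i\<in>{1..card V}. z i) (\<iota> v))"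
    by (simp add: hypergraph_fun_def hpoly_def cube_def)
  also have "\<dots> = hpoly \<E> (\<lambda>v. z (\<iota> v))"
    using assms(2) by (intro hpoly_cong[OF assms(1)]) auto
  finally show ?thesis .
qed

lemma minor_iff:
  "minor (m, g) f \<longleftrightarrow>
    (\<exists>\<sigma> \<in> {1..fst f} \<rightarrow> {1..m}. \<forall>x\<in>cube m. g x = snd f (\<lambda>i\<in>{1..fst f}. x (\<sigma> i)))"
  by (cases f) (simp add: minor_def)

text \<open>A left inverse of an injective substitution undoes it, so no information about
  \<open>f\<close> is lost.\<close>

lemma minor_sym_of_inj:
  assumes "f \<in> Omega" and \<sigma>: "\<sigma> \<in> {1..fst f} \<rightarrow> {1..m}" and inj: "inj_on \<sigma> {1..fst f}"
    and g: "\<And>x. x \<in> cube m \<Longrightarrow> g x = snd f (\<lambda>i\<in>{1..fst f}. x (\<sigma> i))"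
  shows "minor f (m, g)"
proof -
  obtain n h where f: "f = (n, h)" by fastforce
  have n: "1 \<le> n" using assms(1) f by (auto simp: Omega_def)
  \<comment> \<open>Outside the image of \<open>\<sigma>\<close> the value is arbitrary, because
    \<open>g\<close> ignores those variables; 1 is a legal index since \<open>n\<close> is
    positive.\<close>
  define \<tau> where "\<tau> j = (if j \<in> \<sigma> ` {1..n} then inv_into {1..n} \<sigma> j else 1)" for j
  have \<tau>\<sigma>: "\<tau> (\<sigma> i) = i" if "i \<in> {1..n}" for i
    using that inj f by (auto simp: \<tau>_def)
  have \<tau>: "\<tau> \<in> {1..m} \<rightarrow> {1..n}"
  proof
    fix j
    show "\<tau> j \<in> {1..n}"
      using n inv_into_into[of j \<sigma> "{1..n}"] by (auto simp: \<tau>_def)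
  qed
  have "h x = g (\<lambda>j\<in>{1..m}. x (\<tau> j))" if x: "x \<in> cube n" for x
  proof -
    have "(\<lambda>i\<in>{1..n}. (\<lambda>j\<in>{1..m}. x (\<tau> j)) (\<sigma> i)) = x"
    proof
      fix i
      show "(\<lambda>i\<in>{1..n}. (\<lambda>j\<in>{1..m}. x (\<tau> j)) (\<sigma> i)) i = x i"
        using x \<sigma> \<tau>\<sigma>[of i] f
        by (cases "i \<in> {1..n}") (auto simp: cube_def PiE_def extensional_def Pi_def)
    qed
    then show ?thesis
      using f by (subst g) (auto simp: cube_def)
  qed
  with \<tau> show ?thesis unfolding f by (auto simp: minor_def)
qed

theorem corollary13:
  fixes V :: "'a set" and \<E> :: "'a set set" and \<iota> :: "'a \<Rightarrow> nat"
  assumes "hypergraph V \<E>"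
    and "bij_betw \<iota> V {1..card V}"
    and "card V \<ge> 2"
    and "\<Union>\<E> = V"
    and "two_set_transitive_action (Aut V \<E>) V (\<lambda>\<phi>. \<phi>)"
  shows "irreducible_bool_fun (hypergraph_fun \<iota> V \<E>)"
proof -
  define n where "n = card V"
  define f where "f = hypergraph_fun \<iota> V \<E>"
  have finV: "finite V" and \<E>: "\<E> \<subseteq> Pow V"
    using assms(1) by (auto simp: hypergraph_def)
  have n: "2 \<le> n" and \<iota>: "bij_betw \<iota> V {1..n}"
    using assms(2,3) by (auto simp: n_def)
  have \<iota>_im: "\<iota> ` V = {1..n}" and \<iota>_inj: "inj_on \<iota> V"
    using \<iota> by (auto simp: bij_betw_def)
  have fst_f: "fst f = n" by (simp add: f_def hypergraph_fun_def n_def)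
  have eval_f: "snd f (\<lambda>i\<in>{1..n}. z i) = hpoly \<E> (\<lambda>v. z (\<iota> v))" for z
    using snd_hypergraph_fun[OF \<E>, of \<iota> z] \<iota>_im by (simp add: f_def n_def)
  have f_Omega: "f \<in> Omega"
    using n by (auto simp: f_def Omega_def hypergraph_fun_def n_def)
  \<comment> \<open>Merging the last variable into the first leaves the index set
    \<open>{1..n - 1}\<close>, which is nonempty because \<open>2 \<le> n\<close>. The function
    \<open>f'\<close> is the resulting minor.\<close>
  define \<pi> where "\<pi> i = (if i = n then 1 else i)" for i
  have \<pi>: "\<pi> \<in> {1..n} \<rightarrow> {1..n - 1}" using n by (auto simp: \<pi>_def)
  define f' where "f' = (n - 1, \<lambda>x\<in>cube (n - 1). hpoly \<E> (\<lambda>v. x (\<pi> (\<iota> v))))"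
  have f'_Omega: "f' \<in> Omega" using n by (auto simp: f'_def Omega_def)
  have eval_f': "snd f' (\<lambda>j\<in>{1..n - 1}. z j) = hpoly \<E> (\<lambda>v. z (\<pi> (\<iota> v)))" for z
  proof -
    have "snd f' (\<lambda>j\<in>{1..n - 1}. z j) = hpoly \<E> (\<lambda>v. (\<lambda>j\<in>{1..n - 1}. z j) (\<pi> (\<iota> v)))"
      by (simp add: f'_def cube_def)
    also have "\<dots> = hpoly \<E> (\<lambda>v. z (\<pi> (\<iota> v)))"
    proof (rule hpoly_cong[OF \<E>])
      fix v assume "v \<in> V"
      then have "\<pi> (\<iota> v) \<in> {1..n - 1}" using \<pi> \<iota>_im by blast
      then show "(\<lambda>j\<in>{1..n - 1}. z j) (\<pi> (\<iota> v)) = z (\<pi> (\<iota> v))" by simp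
    qed
    finally show ?thesis .
  qed
  have "minor f' f"
    unfolding f'_def minor_iff fst_f eval_f using \<pi> by (intro bexI[of _ \<pi>]) auto
  moreover have "\<not> minor f f'"
  proof
    assume "minor f f'"
    moreover obtain h where f: "f = (n, h)" using fst_f by (cases f) auto
    moreover have fst_f': "fst f' = n - 1" by (simp add: f'_def)
    ultimately obtain \<tau> where \<tau>: "\<tau> \<in> {1..n - 1} \<rightarrow> {1..n}"
      and h: "\<And>x. x \<in> cube n \<Longrightarrow> h x = snd f' (\<lambda>i\<in>{1..n - 1}. x (\<tau> i))"
      unfolding f minor_iff fst_f' by blast
    have eq: "snd f x = hpoly \<E> (\<lambda>v. x (\<tau> (\<pi> (\<iota> v))))" if "x \<in> cube n" for x
      using h[OF that] by (simp only: eval_f' f snd_conv)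
    \<comment> \<open>By counting, \<open>\<tau>\<close> misses some index \<open>k\<close>, so
      \<open>f\<close> could not depend on its \<open>k\<close>-th variable.\<close>
    have "card (\<tau> ` {1..n - 1}) < n"
      using card_image_le[of "{1..n - 1}" \<tau>] n by simp
    then have "\<tau> ` {1..n - 1} \<noteq> {1..n}" by auto
    moreover have "\<tau> ` {1..n - 1} \<subseteq> {1..n}" using \<tau> by auto
    ultimately obtain k where k: "k \<in> {1..n}" "k \<notin> \<tau> ` {1..n - 1}" by blast
    then obtain v where v: "v \<in> V" "k = \<iota> v" using \<iota>_im by blast
    obtain y where y: "hpoly \<E> (y(v := 0)) \<noteq> hpoly \<E> (y(v := 1))"
      using hpoly_depends_on[OF finV \<E>] v assms(4) by blast
    define z where "z = (\<lambda>i. y (inv_into V \<iota> i))"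
    \<comment> \<open>The right side does not mention \<open>b\<close>, so taking \<open>b\<close>
      to be 0 and 1 contradicts the choice of \<open>y\<close>.\<close>
    have "hpoly \<E> (y(v := b)) = hpoly \<E> (\<lambda>v. z (\<tau> (\<pi> (\<iota> v))))" for b
    proof -
      let ?z = "z(k := b)"
      have "hpoly \<E> (y(v := b)) = hpoly \<E> (\<lambda>v. ?z (\<iota> v))"
        using v \<iota>_inj by (intro hpoly_cong[OF \<E>]) (auto simp: z_def inj_on_eq_iff)
      also have "\<dots> = snd f (\<lambda>i\<in>{1..n}. ?z i)" by (simp only: eval_f)
      also have "\<dots> = hpoly \<E> (\<lambda>v. (\<lambda>i\<in>{1..n}. ?z i) (\<tau> (\<pi> (\<iota> v))))"
        by (rule eq) (simp add: cube_def)
      also have "\<dots> = hpoly \<E> (\<lambda>v. z (\<tau> (\<pi> (\<iota> v))))"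
      proof (rule hpoly_cong[OF \<E>])
        fix w assume "w \<in> V"
        then have "\<pi> (\<iota> w) \<in> {1..n - 1}" using \<pi> \<iota>_im by blast
        then have "\<tau> (\<pi> (\<iota> w)) \<in> {1..n}" "\<tau> (\<pi> (\<iota> w)) \<noteq> k" using \<tau> k by blast+
        then show "(\<lambda>i\<in>{1..n}. ?z i) (\<tau> (\<pi> (\<iota> w))) = z (\<tau> (\<pi> (\<iota> w)))" by simp
      qed
      finally show ?thesis .
    qed
    with y show False by metis
  qed
  moreover have "minor g f'" if g_below: "strict_minor g f" for g
  proof -
    obtain m h where g: "g = (m, h)" by fastforce
    obtain \<sigma> where \<sigma>: "\<sigma> \<in> {1..n} \<rightarrow> {1..m}"
      and h: "\<And>x. x \<in> cube m \<Longrightarrow> h x = snd f (\<lambda>i\<in>{1..n}. x (\<sigma> i))"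
      using g_below unfolding strict_minor_def g minor_iff fst_f by blast
    have "\<not> inj_on \<sigma> {1..n}"
      using minor_sym_of_inj[OF f_Omega, of \<sigma> m h] \<sigma> h g_below
      by (auto simp: fst_f strict_minor_def g)
    then have "\<not> inj_on (\<sigma> \<circ> \<iota>) V"
      using inj_on_imageI2 \<iota>_im comp_inj_on_iff[OF \<iota>_inj] by metis
    then obtain p q where pq: "p \<in> V" "q \<in> V" "p \<noteq> q" "\<sigma> (\<iota> p) = \<sigma> (\<iota> q)"
      by (auto simp: inj_on_def)
    \<comment> \<open>These are the two vertices whose variables \<open>\<pi>\<close> merges;
      \<open>p\<close> and \<open>q\<close> are two that \<open>\<sigma>\<close> merges.\<close>
    define a b where "a = inv_into V \<iota> 1" and "b = inv_into V \<iota> n"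
    have ab: "a \<in> V" "b \<in> V" "\<iota> a = 1" "\<iota> b = n"
      unfolding a_def b_def using n \<iota>_im by (auto intro!: inv_into_into f_inv_into_f)
    then have "a \<noteq> b" using n by auto
    then obtain \<phi> where "\<phi> \<in> carrier (Aut V \<E>)" and \<phi>_ab: "\<phi> ` {a, b} = {p, q}"
      using two_set_transitive_action.two_set_transitive[OF assms(5), of "{a, b}" "{p, q}"] ab pq
      by auto
    then have \<phi>: "\<phi> \<in> hypergraph_automorphisms V \<E>" by (simp add: Aut_def)
    then have \<phi>_V: "\<phi> \<in> V \<rightarrow> V"
      by (auto simp: hypergraph_automorphisms_def dest: Bij_imp_funcset)
    \<comment> \<open>Transitivity on 2-sets leaves open which of \<open>a\<close>, \<open>b\<close>
      goes to \<open>p\<close>; both cases give this equation.\<close>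
    have \<sigma>_ab: "\<sigma> (\<iota> (\<phi> a)) = \<sigma> (\<iota> (\<phi> b))"
      using \<phi>_ab pq by (auto simp: doubleton_eq_iff)
    \<comment> \<open>After twisting by \<open>\<phi>\<close>, the substitution
      \<open>\<sigma>\<close> takes equal values at the indices 1 and \<open>n\<close>, hence
      factors through \<open>\<pi>\<close>; \<open>\<rho>\<close> is the other factor.\<close>
    define \<rho> where "\<rho> j = \<sigma> (\<iota> (\<phi> (inv_into V \<iota> j)))" for j
    have \<rho>_\<pi>: "\<rho> (\<pi> (\<iota> v)) = \<sigma> (\<iota> (\<phi> v))" if "v \<in> V" for v
    proof (cases "\<iota> v = n")
      case True
      then have "v = b" using that \<iota>_inj by (simp add: b_def[symmetric] ab inj_on_eq_iff[symmetric])
      with True \<sigma>_ab show ?thesis by (simp add: \<rho>_def \<pi>_def a_def)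
    next
      case False
      with that \<iota>_inj show ?thesis by (simp add: \<rho>_def \<pi>_def)
    qed
    have "\<rho> \<in> {1..n - 1} \<rightarrow> {1..m}"
    proof
      fix j assume "j \<in> {1..n - 1}"
      then have "j \<in> \<iota> ` V" using \<iota>_im by auto
      then have "\<iota> (\<phi> (inv_into V \<iota> j)) \<in> {1..n}"
        using \<phi>_V \<iota>_im inv_into_into[of j \<iota> V] by blast
      then show "\<rho> j \<in> {1..m}" using \<sigma> unfolding \<rho>_def by blast
    qed
    moreover have "h x = snd f' (\<lambda>j\<in>{1..n - 1}. x (\<rho> j))" if x: "x \<in> cube m" for x
    proof -
      have "h x = hpoly \<E> (\<lambda>v. x (\<sigma> (\<iota> v)))" by (simp only: h[OF x] eval_f)
      \<comment> \<open>Invariance of the polynomial makes the twist by \<open>\<phi>\<close>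
        free.\<close>
      also have "\<dots> = hpoly \<E> (\<lambda>v. x (\<sigma> (\<iota> (\<phi> v))))"
        by (rule hpoly_automorphism[OF \<E> \<phi>, symmetric])
      also have "\<dots> = hpoly \<E> (\<lambda>v. x (\<rho> (\<pi> (\<iota> v))))"
        by (intro hpoly_cong[OF \<E>]) (simp add: \<rho>_\<pi>)
      finally show ?thesis by (simp only: eval_f')
    qed
    moreover have "fst f' = n - 1" by (simp add: f'_def)
    ultimately show ?thesis unfolding g minor_iff by auto
  qed
  ultimately show ?thesis
    using f_Omega f'_Omega unfolding irreducible_bool_fun_def strict_minor_def f_def by blast
qed

end
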